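(* For every integer $r\ge 1$ and every complex $s$ with $\Re s>1$, \[ (-1)^r\,\xi(2,\underbrace{1,\ldots,1}_{r};s)= -(r+1)\,\zeta(r+2;s)-s\,\zeta(r+1;s+1)+\sum_{j=0}^{r}(-1)^j (r-j+1)\,\zeta(r-j+2)\binom{s+j-1}{j}\zeta(s+j). \]
   Context: For integers $k_1,\ldots,k_r$ and $|z|<1$, $\mathrm{Li}_{k_1,\ldots,k_r}(z)=\sum_{1\le m_1<\cdots<m_r}\frac{z^{m_r}}{m_1^{k_1}\cdots m_r^{k_r}}$. For positive integers $k_1,\ldots,k_r$ and $\Re s>0$, \[\xi(k_1,\ldots,k_r;s)=\frac{1}{\Gamma(s)}\int_0^\infty t^{s-1}\frac{\mathrm{Li}_{k_1,\ldots,k_r}(1-e^{-t})}{e^t-1}\,dt,\] which extends to an entire function of $s$. For a positive integer $k$ and $\Re s>1$, $\zeta(k;s)=\sum_{1\le m_1<m}\frac{1}{m_1^{k}m^s}$ (single-variable double zeta function); $\zeta(s)$ is the Riemann zeta function, and $\binom{s+j-1}{j}=\frac{s(s+1)\cdots(s+j-1)}{j!}$. *)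

theory Defs
  imports "HOL-Analysis.Analysis"
begin

(* Multiple polylogarithm, for non-empty ks and norm z < 1. The index tuples (m_1, ..., m_r) are
   lists, so m_i is ms ! (i - 1) and the largest index m_r is last ms. For these z the sum is
   absolutely convergent, so the unordered sum is the iterated one. *)
definition Li :: "int list \<Rightarrow> complex \<Rightarrow> complex" where
  "Li ks z =
     (\<Sum>\<^sub>\<infinity>ms\<in>{ms :: nat list. length ms = length ks \<and> sorted_wrt (<) ms \<and> (\<forall>m\<in>set ms. 1 \<le> m)}.
        z ^ last ms / (\<Prod>i<length ks. of_nat (ms ! i) powi (ks ! i)))"

(* Arakawa-Kaneko xi function in the half-plane Re s > 0, where the integral converges absolutely;
   its entire continuation is not covered. The k_i are meant to be positive. *)
definition xi :: "nat list \<Rightarrow> complex \<Rightarrow> complex" where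
  "xi ks s =
     1 / Gamma s *
     (LBINT t:{0<..}. of_real t powr (s - 1) * Li (map int ks) (1 - exp (- of_real t))
                        / (exp (of_real t) - 1))"

(* Riemann zeta function by its Dirichlet series; only meaningful for Re s > 1. *)
definition riemann_zeta :: "complex \<Rightarrow> complex" where
  "riemann_zeta s = (\<Sum>\<^sub>\<infinity>m\<in>{1 :: nat..}. 1 / of_nat m powr s)"

(* Single-variable double zeta function, for k \<ge> 1 and Re s > 1; the exponent s belongs to the
   larger summation index. *)
definition double_zeta :: "nat \<Rightarrow> complex \<Rightarrow> complex" where
  "double_zeta k s =
     (\<Sum>\<^sub>\<infinity>(m\<^sub>1, m)\<in>{(m\<^sub>1 :: nat, m :: nat). 1 \<le> m\<^sub>1 \<and> m\<^sub>1 < m}. 1 / (of_nat m\<^sub>1 ^ k * of_nat m powr s))"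

end

(* Put x = 1 - exp (-t). Differentiating Li_{2,1,...,1} (x) in t drops one of the 1s, and
   d/dt Li_2 (x) = t / (e^t - 1). The function iter_closed below, a polynomial in t plus terms in
   Li_k (exp (-t)), satisfies the same system up to alternating signs, and both sides vanish as
   t -> 0+, so they agree. Dividing by e^t - 1 turns every term into a power of t times a power
   series in exp (-t) with bounded coefficients, whose Mellin transform is computed termwise. *)
theory Submission
  imports Defs "HOL-Real_Asymp.Real_Asymp"
begin

text \<open>The closed form comes from the family t * Li_{r+1}(e^{-t}) + (r+1) * Li_{r+2}(e^{-t}),
  whose derivative is minus its predecessor: the product rule contributes one extra Li_{r+1}, which
  lowers the coefficient r+1 to r. Integrating back needs one constant per level to make the result
  vanish at 0+, namely (r+1) * zeta(r+2); repeated integration of these constants produces the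
  polynomial, hence the finite sum of the theorem. Division by e^t - 1 replaces a coefficient
  sequence by its partial sums, and this is how zeta(k;s) arises from Li_k. These partial sums are
  bounded only for k >= 2, which is where r >= 1 enters. As t -> 0+, the argument e^{-t} reaches the
  boundary of the disc of convergence, so initial conditions are stated as limits. Only the factor
  t^(s-1) is complex; all series are handled over the reals.\<close>

section \<open>Power series with bounded coefficients\<close>

definition powser :: "(nat \<Rightarrow> real) \<Rightarrow> real \<Rightarrow> real" where
  "powser a x = (\<Sum>n. a n * x ^ n)"

lemma summable_powser:
  fixes a :: "nat \<Rightarrow> real"
  assumes "\<And>n. \<bar>a n\<bar> \<le> C" "\<bar>x\<bar> < 1"
  shows "summable (\<lambda>n. norm (a n * x ^ n))"
proof (rule summable_comparison_test')
  show "summable (\<lambda>n. C * \<bar>x\<bar> ^ n)"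
    using assms by (intro summable_mult summable_geometric) auto
  show "norm (norm (a n * x ^ n)) \<le> C * \<bar>x\<bar> ^ n" if "n \<ge> 0" for n
    using assms(1)[of n] by (auto simp: abs_mult power_abs intro!: mult_right_mono)
qed

lemma powser_sums:
  assumes "\<And>n. \<bar>a n\<bar> \<le> C" "\<bar>x\<bar> < 1"
  shows "(\<lambda>n. a n * x ^ n) sums powser a x"
  unfolding powser_def
  using summable_norm_cancel[OF summable_powser[OF assms]] by (rule summable_sums)

text \<open>Cauchy product with the geometric series. This is the mechanism that creates nested
  sums.\<close>

lemma powser_sums_atMost:
  assumes "\<And>n. \<bar>a n\<bar> \<le> C" "\<bar>x\<bar> < 1"
  shows "(\<lambda>n. (\<Sum>k\<le>n. a k) * x ^ n) sums (powser a x / (1 - x))"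
proof -
  have "(\<lambda>k. \<Sum>i\<le>k. (a i * x ^ i) * x ^ (k - i)) sums ((\<Sum>k. a k * x ^ k) * (\<Sum>k. x ^ k))"
  proof (rule Cauchy_product_sums)
    show "summable (\<lambda>k. norm (a k * x ^ k))" by (rule summable_powser[OF assms])
    show "summable (\<lambda>k. norm (x ^ k))"
      using assms(2) by (simp add: power_abs summable_geometric)
  qed
  also have "(\<Sum>k. x ^ k) = 1 / (1 - x)"
    using assms by (simp add: suminf_geometric)
  also have "(\<lambda>k. \<Sum>i\<le>k. (a i * x ^ i) * x ^ (k - i)) = (\<lambda>n. (\<Sum>k\<le>n. a k) * x ^ n)"
    by (auto simp: sum_distrib_right mult.assoc simp flip: power_add intro!: ext sum.cong)
  finally show ?thesis by (simp add: powser_def)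
qed

text \<open>The extra factor x shifts the index and makes the partial sum strict, as the condition
  m_1 < m in \<open>double_zeta\<close> requires; for x = e^{-t} the factor x / (1 - x) is 1 / (e^t
  - 1).\<close>

lemma powser_sums_lessThan:
  assumes "\<And>n. \<bar>a n\<bar> \<le> C" "\<bar>x\<bar> < 1"
  shows "(\<lambda>n. (\<Sum>k<n. a k) * x ^ n) sums (x / (1 - x) * powser a x)"
proof -
  have "(\<lambda>n. x * ((\<Sum>k\<le>n. a k) * x ^ n)) sums (x * (powser a x / (1 - x)))"
    by (intro sums_mult powser_sums_atMost[OF assms])
  hence "(\<lambda>n. (\<Sum>k<Suc n. a k) * x ^ Suc n) sums (x / (1 - x) * powser a x)"
    by (simp add: lessThan_Suc_atMost mult_ac)
  from sums_Suc[OF this] show ?thesis by simp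
qed

lemma has_real_derivative_powser:
  assumes "\<And>n. \<bar>a n\<bar> \<le> C" "\<bar>x\<bar> < 1"
  shows "(powser a has_real_derivative (\<Sum>n. real (Suc n) * a (Suc n) * x ^ n)) (at x)"
proof -
  have "((\<lambda>x. \<Sum>n. a n * x ^ n) has_real_derivative (\<Sum>n. diffs a n * x ^ n)) (at x)"
    by (rule termdiffs_strong'[where K = 1])
       (use assms summable_norm_cancel[OF summable_powser[OF assms(1)]] in auto)
  thus ?thesis by (simp add: powser_def[abs_def] diffs_def)
qed

section \<open>Coefficients of Li_{2,1,...,1} and of Li_k\<close>

text \<open>The coefficient of x^m in Li_{2,1,...,1}(x) with r ones, by recursion on the largest
  index. Division by zero yields 0 at m = 0, so the summand k = 0 is harmless.\<close>

fun Li_coeff :: "nat \<Rightarrow> nat \<Rightarrow> real" where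
  "Li_coeff 0 m = 1 / real m ^ 2"
| "Li_coeff (Suc r) m = (\<Sum>k<m. Li_coeff r k) / real m"

lemma Li_coeff_0 [simp]: "Li_coeff r 0 = 0"
  by (cases r) auto

lemma Li_coeff_nonneg: "Li_coeff r m \<ge> 0"
  by (induction r arbitrary: m) (auto intro!: divide_nonneg_nonneg sum_nonneg)

text \<open>For m > 0, \<open>Li_coeff (Suc r) m\<close> is the mean of m numbers that are at most
  1.\<close>

lemma Li_coeff_le_1: "Li_coeff r m \<le> 1"
proof (induction r arbitrary: m)
  case 0
  show ?case by (cases "m = 0") (auto simp: divide_simps)
next
  case (Suc r)
  have "(\<Sum>k<m. Li_coeff r k) \<le> (\<Sum>k<m. 1)" by (intro sum_mono Suc)
  thus ?case by (cases "m = 0") (auto simp: divide_simps)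
qed

lemma abs_Li_coeff_le_1: "\<bar>Li_coeff r m\<bar> \<le> 1"
  using Li_coeff_nonneg[of r m] Li_coeff_le_1[of r m] by simp

text \<open>Termwise differentiation cancels the outer factor 1/m and leaves the partial sums of
  \<open>Li_coeff r\<close>, which are the coefficients of a product with 1 / (1 - x).\<close>

lemma has_real_derivative_powser_Li_coeff_Suc:
  assumes "\<bar>x\<bar> < 1"
  shows "(powser (Li_coeff (Suc r)) has_real_derivative powser (Li_coeff r) x / (1 - x)) (at x)"
proof -
  have "(\<lambda>n. real (Suc n) * Li_coeff (Suc r) (Suc n) * x ^ n) sums (powser (Li_coeff r) x / (1 - x))"
    using powser_sums_atMost[where a = "Li_coeff r", OF abs_Li_coeff_le_1 assms]
    by (simp add: lessThan_Suc_atMost del: of_nat_Suc)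
  thus ?thesis
    using has_real_derivative_powser[where a = "Li_coeff (Suc r)", OF abs_Li_coeff_le_1 assms]
    by (simp add: sums_iff)
qed

(* The explicit case n = 0 is needed for k = 0, where 1 / 0 ^ 0 = 1. *)
definition inv_power :: "nat \<Rightarrow> nat \<Rightarrow> real" where
  "inv_power k n = (if n = 0 then 0 else 1 / real n ^ k)"

lemma inv_power_0 [simp]: "inv_power k 0 = 0"
  by (simp add: inv_power_def)

lemma inv_power_nonneg: "inv_power k n \<ge> 0"
  by (simp add: inv_power_def)

lemma inv_power_le_1: "inv_power k n \<le> 1"
  by (simp add: inv_power_def divide_simps)

lemma abs_inv_power_le_1: "\<bar>inv_power k n\<bar> \<le> 1"
  using inv_power_nonneg[of k n] inv_power_le_1[of k n] by simp

lemma powser_inv_power_sums: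
  assumes "\<bar>x\<bar> < 1" "x \<noteq> 0"
  shows "(\<lambda>n. inv_power k (Suc n) * x ^ n) sums (powser (inv_power k) x / x)"
proof -
  have "(\<lambda>n. inv_power k (Suc n) * x ^ Suc n) sums powser (inv_power k) x"
    using powser_sums[where a = "inv_power k", OF abs_inv_power_le_1 assms(1)] by (subst sums_Suc_iff) simp
  from sums_divide[OF this, of x] show ?thesis using assms by simp
qed

lemma has_real_derivative_powser_inv_power_Suc:
  assumes "\<bar>x\<bar> < 1" "x \<noteq> 0"
  shows "(powser (inv_power (Suc k)) has_real_derivative powser (inv_power k) x / x) (at x)"
proof -
  have eq: "real (Suc n) * inv_power (Suc k) (Suc n) = inv_power k (Suc n)" for n
    by (simp add: inv_power_def del: of_nat_Suc)
  show ?thesis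
    using has_real_derivative_powser[where a = "inv_power (Suc k)", OF abs_inv_power_le_1 assms(1)]
          powser_inv_power_sums[OF assms, of k]
    unfolding eq by (simp add: sums_iff)
qed

lemma powser_inv_power_0:
  assumes "\<bar>x\<bar> < 1"
  shows "powser (inv_power 0) x = x / (1 - x)"
proof -
  have "(\<lambda>n. x * x ^ n) sums (x * (1 / (1 - x)))"
    using assms by (intro sums_mult geometric_sums) auto
  hence "(\<lambda>n. inv_power 0 (Suc n) * x ^ Suc n) sums (x / (1 - x))"
    by (simp add: inv_power_def)
  from sums_Suc[OF this] show ?thesis by (simp add: powser_def sums_iff)
qed

lemma powser_inv_power_1:
  assumes "\<bar>x\<bar> < 1"
  shows "powser (inv_power 1) x = - ln (1 - x)"
proof -
  have "(\<lambda>n. - (- (x ^ n) / real n)) sums (- ln (1 - x))"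
    using ln_series'[of "-x"] assms by (intro sums_minus) simp
  also have "(\<lambda>n. - (- (x ^ n) / real n)) = (\<lambda>n. inv_power 1 n * x ^ n)"
    by (auto simp: inv_power_def)
  finally show ?thesis by (simp add: powser_def sums_iff)
qed

lemma has_real_derivative_powser_Li_coeff_0:
  assumes "\<bar>x\<bar> < 1" "x \<noteq> 0"
  shows "(powser (Li_coeff 0) has_real_derivative - ln (1 - x) / x) (at x)"
proof -
  have "Li_coeff 0 = inv_power 2" by (auto simp: inv_power_def)
  thus ?thesis
    using has_real_derivative_powser_inv_power_Suc[OF assms, of 1] powser_inv_power_1[OF assms(1)]
    by (simp add: numeral_2_eq_2)
qed

lemma summable_inv_power:
  assumes "k \<ge> 2"
  shows "summable (inv_power k)"
proof -
  have "inv_power k = (\<lambda>n. inverse (real n ^ k))"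
    using assms by (auto simp: inv_power_def inverse_eq_divide)
  thus ?thesis using inverse_power_summable[OF assms, where 'a = real] by simp
qed

text \<open>The M-test reaches the endpoint x = 1, which is the point approached by e^{-t} as t ->
  0+.\<close>

lemma continuous_on_powser_inv_power:
  assumes "k \<ge> 2"
  shows "continuous_on {-1..1} (powser (inv_power k))"
proof (rule uniform_limit_theorem)
  show "uniform_limit {-1..1} (\<lambda>n x. \<Sum>i<n. inv_power k i * x ^ i) (powser (inv_power k)) sequentially"
    unfolding powser_def[abs_def]
  proof (rule Weierstrass_m_test[OF _ summable_inv_power[OF assms]])
    fix n x assume "x \<in> {-1..1::real}"
    hence "\<bar>x\<bar> ^ n \<le> 1" by (intro power_le_one) auto
    thus "norm (inv_power k n * x ^ n) \<le> inv_power k n"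
      using inv_power_nonneg[of k n] by (simp add: abs_mult power_abs mult_left_le)
  qed
qed (auto intro!: continuous_intros always_eventually)

section \<open>Polylogarithms at exp (-t) and their behaviour at 0+\<close>

text \<open>This is zeta(k) for k >= 2, written as a boundary value of the power series so that
  continuity yields it as a limit.\<close>

definition zeta_real :: "nat \<Rightarrow> real" where
  "zeta_real k = powser (inv_power k) 1"

abbreviation Li_exp :: "nat \<Rightarrow> real \<Rightarrow> real" where
  "Li_exp k t \<equiv> powser (inv_power k) (exp (- t))"

lemma has_real_derivative_Li_exp:
  assumes "t > 0"
  shows "(Li_exp (Suc k) has_real_derivative - Li_exp k t) (at t)"
proof -
  have "((\<lambda>t. powser (inv_power (Suc k)) (exp (- t))) has_real_derivative
          powser (inv_power k) (exp (- t)) / exp (- t) * (- exp (- t))) (at t)"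
    by (rule DERIV_chain2[OF has_real_derivative_powser_inv_power_Suc])
       (use assms in \<open>auto intro!: derivative_eq_intros\<close>)
  thus ?thesis by simp
qed

lemma tendsto_Li_exp:
  assumes "k \<ge> 2"
  shows "(Li_exp k \<longlongrightarrow> zeta_real k) (at_right 0)"
proof -
  have "continuous_on {0..} (Li_exp k)"
    by (rule continuous_on_compose2[OF continuous_on_powser_inv_power[OF assms]])
       (auto intro!: continuous_intros order.trans[OF _ exp_ge_zero])
  hence "(Li_exp k \<longlongrightarrow> Li_exp k 0) (at 0 within {0..})"
    unfolding continuous_on_def by (rule bspec) simp
  hence "(Li_exp k \<longlongrightarrow> Li_exp k 0) (at_right 0)"
    by (rule tendsto_within_subset) auto
  thus ?thesis by (simp add: zeta_real_def)
qed

lemma Li_exp_0: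
  assumes "t > 0"
  shows "Li_exp 0 t = 1 / (exp t - 1)"
  using assms by (simp add: powser_inv_power_0 exp_minus field_simps)

text \<open>The singularity of Li_1(e^{-t}) at 0 is only logarithmic, so the factor t removes it.
  This covers \<open>iter_closed 0\<close>, the one level in which Li_1 occurs.\<close>

lemma tendsto_times_Li_exp_1: "((\<lambda>t. t * Li_exp 1 t) \<longlongrightarrow> 0) (at_right 0)"
proof -
  have "((\<lambda>t::real. - (t * ln (1 - exp (- t)))) \<longlongrightarrow> 0) (at_right 0)"
    by real_asymp
  moreover have "eventually (\<lambda>t. t * Li_exp 1 t = - (t * ln (1 - exp (- t)))) (at_right 0)"
    using eventually_at_right_less[of 0] by eventually_elim (simp add: powser_inv_power_1[simplified])
  ultimately show ?thesis by (simp cong: tendsto_cong)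
qed

section \<open>Two solutions of one differential system\<close>

definition iter_Li :: "nat \<Rightarrow> real \<Rightarrow> real" where
  "iter_Li r t = powser (Li_coeff r) (1 - exp (- t))"

text \<open>The chain rule factor e^{-t} equals 1 - x for x = 1 - e^{-t} and cancels the
  denominator.\<close>

lemma has_real_derivative_iter_Li_Suc:
  assumes "t > 0"
  shows "(iter_Li (Suc r) has_real_derivative iter_Li r t) (at t)"
proof -
  have "((\<lambda>t. powser (Li_coeff (Suc r)) (1 - exp (- t))) has_real_derivative
          powser (Li_coeff r) (1 - exp (- t)) / (1 - (1 - exp (- t))) * exp (- t)) (at t)"
    by (rule DERIV_chain2[OF has_real_derivative_powser_Li_coeff_Suc])
       (use assms in \<open>auto intro!: derivative_eq_intros\<close>)
  thus ?thesis by (simp add: iter_Li_def[abs_def])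
qed

text \<open>The substitution makes the logarithm in the derivative of Li_2 linear: ln (1 - x) =
  -t.\<close>

lemma has_real_derivative_iter_Li_0:
  assumes "t > 0"
  shows "(iter_Li 0 has_real_derivative t / (exp t - 1)) (at t)"
proof -
  have "((\<lambda>t. powser (Li_coeff 0) (1 - exp (- t))) has_real_derivative
          - ln (1 - (1 - exp (- t))) / (1 - exp (- t)) * exp (- t)) (at t)"
    by (rule DERIV_chain2[OF has_real_derivative_powser_Li_coeff_0])
       (use assms in \<open>auto intro!: derivative_eq_intros\<close>)
  also have "- ln (1 - (1 - exp (- t))) / (1 - exp (- t)) * exp (- t) = t / (exp t - 1)"
    using assms by (simp add: field_simps flip: exp_add)
  finally show ?thesis unfolding iter_Li_def[abs_def] .
qed

lemma tendsto_iter_Li: "(iter_Li r \<longlongrightarrow> 0) (at_right 0)"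
proof -
  have "isCont (powser (Li_coeff r)) 0"
    by (rule DERIV_isCont[OF has_real_derivative_powser[OF abs_Li_coeff_le_1]]) simp
  moreover have "((\<lambda>t::real. 1 - exp (- t)) \<longlongrightarrow> 0) (at_right 0)" by real_asymp
  ultimately have "((\<lambda>t. powser (Li_coeff r) (1 - exp (- t))) \<longlongrightarrow> powser (Li_coeff r) 0) (at_right 0)"
    by (rule isCont_tendsto_compose)
  moreover have "powser (Li_coeff r) 0 = 0" by (simp add: powser_def)
  ultimately show ?thesis by (simp add: iter_Li_def[abs_def])
qed

text \<open>The summand with index j is the integration constant of level r - j, integrated j more
  times; each integration flips the sign.\<close>

definition iter_closed :: "nat \<Rightarrow> real \<Rightarrow> real" where
  "iter_closed r t = (\<Sum>j\<le>r. (-1) ^ j * real (r - j + 1) * zeta_real (r - j + 2) * t ^ j / fact j)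
                       - t * Li_exp (r + 1) t - real (r + 1) * Li_exp (r + 2) t"

text \<open>The value in the case \<open>0\<close> is what the formula for
  \<open>iter_closed\<close> gives at r = -1: the sum is empty, the last coefficient is 0, and - t *
  Li_0(e^{-t}) remains. Both cases thus express one rule.\<close>

lemma has_real_derivative_iter_closed:
  assumes "t > 0"
  shows "(iter_closed r has_real_derivative
           - (case r of 0 \<Rightarrow> - (t / (exp t - 1)) | Suc r \<Rightarrow> iter_closed r t)) (at t)"
proof -
  let ?c = "\<lambda>r j. (-1) ^ j * real (r - j + 1) * zeta_real (r - j + 2)"
  have L: "((\<lambda>t. t * Li_exp (r + 1) t + real (r + 1) * Li_exp (r + 2) t) has_real_derivative
          (- t * Li_exp r t - real r * Li_exp (r + 1) t)) (at t)"
    using assms has_real_derivative_Li_exp[of t r] has_real_derivative_Li_exp[of t "r+1"]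
    by (auto intro!: derivative_eq_intros simp: algebra_simps)
  have P: "((\<lambda>t. \<Sum>j\<le>r. ?c r j * t ^ j / fact j) has_real_derivative
          - (case r of 0 \<Rightarrow> 0 | Suc r' \<Rightarrow> \<Sum>j\<le>r'. ?c r' j * t ^ j / fact j)) (at t)"
  proof (cases r)
    case (Suc r')
    \<comment> \<open>The term j = 0 is constant. For the others, lowering r and j together keeps r
      - j, so that only the sign of the coefficient changes.\<close>
    have "((\<lambda>t. ?c r 0 + (\<Sum>j\<le>r'. ?c r (Suc j) * (t ^ Suc j / fact (Suc j)))) has_real_derivative
          0 + (\<Sum>j\<le>r'. ?c r (Suc j) * (t ^ j / fact j))) (at t)"
    proof (intro DERIV_add DERIV_const DERIV_sum DERIV_cmult)
      fix j
      have "((\<lambda>t. t ^ Suc j / fact (Suc j)) has_real_derivative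
              real (Suc j) * t ^ j / fact (Suc j)) (at t)"
        by (intro DERIV_cdivide) (use DERIV_pow[of "Suc j" t] in simp)
      thus "((\<lambda>t. t ^ Suc j / fact (Suc j)) has_real_derivative t ^ j / fact j) (at t)"
        by (simp add: fact_Suc del: of_nat_Suc)
    qed
    moreover have "(\<lambda>t. ?c r 0 + (\<Sum>j\<le>r'. ?c r (Suc j) * (t ^ Suc j / fact (Suc j)))) = (\<lambda>t. \<Sum>j\<le>r. ?c r j * t ^ j / fact j)"
      unfolding Suc sum.atMost_Suc_shift by simp
    moreover have "0 + (\<Sum>j\<le>r'. ?c r (Suc j) * (t ^ j / fact j)) = - (\<Sum>j\<le>r'. ?c r' j * t ^ j / fact j)"
      unfolding Suc sum_negf[symmetric] by simp
    ultimately show ?thesis by (simp add: Suc)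
  qed auto
  show ?thesis
    using DERIV_diff[OF P L] assms unfolding iter_closed_def[abs_def]
    by (cases r) (simp_all add: Li_exp_0[simplified] algebra_simps)
qed

lemma tendsto_iter_closed: "(iter_closed r \<longlongrightarrow> 0) (at_right 0)"
proof -
  have T: "((\<lambda>t. t * Li_exp (r + 1) t) \<longlongrightarrow> 0) (at_right 0)"
  proof (cases r)
    case 0
    thus ?thesis using tendsto_times_Li_exp_1 by simp
  next
    case (Suc r')
    have "((\<lambda>t. t * Li_exp (r + 1) t) \<longlongrightarrow> 0 * zeta_real (r + 1)) (at_right 0)"
      by (intro tendsto_intros tendsto_Li_exp) (use Suc in auto)
    thus ?thesis by simp
  qed
  have "(iter_closed r \<longlongrightarrow>
          (\<Sum>j\<le>r. (-1) ^ j * real (r - j + 1) * zeta_real (r - j + 2) * 0 ^ j / fact j)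
            - 0 - real (r + 1) * zeta_real (r + 2)) (at_right 0)"
    unfolding iter_closed_def[abs_def]
    by (intro tendsto_intros T tendsto_Li_exp) auto
  \<comment> \<open>Since 0 ^ j vanishes for j > 0, only (r+1) * zeta(r+2) survives, and it cancels
    the limit of the Li_{r+2} term.\<close>
  also have "(\<Sum>j\<le>r. (-1) ^ j * real (r - j + 1) * zeta_real (r - j + 2) * 0 ^ j / fact j)
               = (\<Sum>j\<in>{0}. (-1) ^ j * real (r - j + 1) * zeta_real (r - j + 2) * 0 ^ j / fact j)"
    by (rule sum.mono_neutral_right) auto
  finally show ?thesis by simp
qed

text \<open>Uniqueness principle for the system: a one-sided limit serves as initial condition,
  because the closed form is controlled only for t > 0.\<close>

lemma eq_0_if_derivative_0_tendsto_0:
  fixes f :: "real \<Rightarrow> real"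
  assumes "\<And>t. t > a \<Longrightarrow> (f has_real_derivative 0) (at t)" "(f \<longlongrightarrow> 0) (at_right a)" "t > a"
  shows "f t = 0"
proof -
  have "\<exists>c. \<forall>x\<in>{a<..}. f x = c"
    by (rule has_field_derivative_zero_constant)
       (auto intro: has_field_derivative_at_within assms(1))
  then obtain c where c: "\<And>x. x > a \<Longrightarrow> f x = c" by auto
  have "eventually (\<lambda>x. f x = c) (at_right a)"
    using eventually_at_right_less[of a] by eventually_elim (simp add: c)
  hence "(f \<longlongrightarrow> c) (at_right a)" by (rule tendsto_eventually)
  with assms(2) have "c = 0" using tendsto_unique trivial_limit_at_right_real by blast
  thus ?thesis using c assms(3) by simp
qed

lemma iter_Li_eq:
  assumes "t > 0"
  shows "(-1) ^ r * iter_Li r t = iter_closed r t"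
  using assms
proof (induction r arbitrary: t)
  case 0
  have "iter_Li 0 t - iter_closed 0 t = 0" using _ _ \<open>t > 0\<close>
  proof (rule eq_0_if_derivative_0_tendsto_0)
    show "((\<lambda>t. iter_Li 0 t - iter_closed 0 t) has_real_derivative 0) (at t)" if "t > 0" for t
      using DERIV_diff[OF has_real_derivative_iter_Li_0 has_real_derivative_iter_closed[of t 0]] that
      by simp
    show "((\<lambda>t. iter_Li 0 t - iter_closed 0 t) \<longlongrightarrow> 0) (at_right 0)"
      using tendsto_diff[OF tendsto_iter_Li tendsto_iter_closed] by simp
  qed
  thus ?case by simp
next
  case (Suc r)
  have "(-1) ^ Suc r * iter_Li (Suc r) t - iter_closed (Suc r) t = 0" using _ _ \<open>t > 0\<close>
  proof (rule eq_0_if_derivative_0_tendsto_0)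
    show "((\<lambda>t. (-1) ^ Suc r * iter_Li (Suc r) t - iter_closed (Suc r) t) has_real_derivative 0) (at t)"
      if "t > 0" for t
      \<comment> \<open>By the induction hypothesis the first derivative is -
        \<open>iter_closed r t\<close>, the same as the second.\<close>
      using DERIV_diff[OF DERIV_cmult[OF has_real_derivative_iter_Li_Suc[OF that, of r], of "(-1) ^ Suc r"]
              has_real_derivative_iter_closed[OF that, of "Suc r"]] Suc.IH[OF that]
      by (simp add: algebra_simps)
    show "((\<lambda>t. (-1) ^ Suc r * iter_Li (Suc r) t - iter_closed (Suc r) t) \<longlongrightarrow> 0) (at_right 0)"
      using tendsto_diff[OF tendsto_mult_left[OF tendsto_iter_Li, of "(-1) ^ Suc r"] tendsto_iter_closed]
      by simp
  qed
  thus ?case by simp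
qed

section \<open>Gamma integrals and termwise Mellin transforms\<close>

lemma cmod_of_real_powr:
  assumes "t > 0"
  shows "norm (complex_of_real t powr z) = t powr Re z"
  using assms by (simp add: norm_powr_real_powr)

lemma norm_of_nat_powr: "n > 0 \<Longrightarrow> norm (complex_of_nat n powr s) = real n powr Re s"
  using cmod_of_real_powr[of "real n" s] by simp

lemma summable_Dirichlet_bounded:
  assumes "\<And>n. \<bar>w n\<bar> \<le> C" "Re s > 1"
  shows "summable (\<lambda>n. norm (complex_of_real (w n) / of_nat n powr s))"
proof (rule summable_comparison_test')
  show "summable (\<lambda>n. C * real n powr (- Re s))"
    using assms by (intro summable_mult) (simp add: summable_real_powr_iff)
  show "norm (norm (of_real (w n) / of_nat n powr s)) \<le> C * real n powr (- Re s)" if "n \<ge> 0" for n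
  proof (cases "n = 0")
    case False
    thus ?thesis using assms(1)[of n] norm_of_nat_powr[of n s]
      by (simp add: norm_mult norm_inverse powr_minus divide_inverse mult_right_mono)
  qed auto
qed

text \<open>The integrand of Gamma(s) / a^s. The built-in indicator makes it a function on the whole
  line, so that affine substitution for \<open>lborel\<close> applies.\<close>

definition Gamma_kernel :: "complex \<Rightarrow> real \<Rightarrow> real \<Rightarrow> complex" where
  "Gamma_kernel s a t = indicator {0<..} t *\<^sub>R (of_real t powr (s - 1) * of_real (exp (- (a * t))))"

lemma has_bochner_integral_Gamma_kernel_1:
  assumes "Re s > 0"
  shows "has_bochner_integral lborel (Gamma_kernel s 1) (Gamma s)"
proof -
  let ?f = "\<lambda>t. complex_of_real t powr (s - 1) / of_real (exp t)"
  have abs: "?f absolutely_integrable_on {0<..}"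
    by (rule absolutely_integrable_Gamma_integral'[OF assms])
  have eq: "Gamma_kernel s 1 = (\<lambda>t. indicator {0<..} t *\<^sub>R ?f t)"
    by (auto simp: Gamma_kernel_def exp_minus field_simps)
  have meas: "Gamma_kernel s 1 \<in> borel_measurable lborel"
    unfolding Gamma_kernel_def[abs_def] measurable_cong_sets[OF sets_lborel refl]
    by (intro borel_measurable_continuous_on_indicator) (auto intro!: continuous_intros)
  \<comment> \<open>Absolute integrability refers to the completed measure; Borel measurability of
    the kernel brings it down to \<open>lborel\<close>.\<close>
  have int: "integrable lborel (Gamma_kernel s 1)"
    using abs meas unfolding set_integrable_def eq by (subst (asm) integrable_completion) auto
  have "integral\<^sup>L lborel (Gamma_kernel s 1) = set_lebesgue_integral lborel {0<..} ?f"
    by (simp add: eq set_lebesgue_integral_def)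
  also have "\<dots> = integral {0<..} ?f"
    by (rule set_borel_integral_eq_integral) (use int in \<open>simp add: set_integrable_def eq\<close>)
  also have "\<dots> = Gamma s" by (rule integral_unique[OF Gamma_integral_complex'[OF assms]])
  finally show ?thesis using int by (simp add: has_bochner_integral_iff)
qed

lemma Gamma_kernel_scale:
  assumes "a > 0"
  shows "Gamma_kernel s a t = of_real a powr (1 - s) * Gamma_kernel s 1 (0 + a * t)"
proof (cases "t > 0")
  case True
  have "complex_of_real (a * t) powr (s - 1) = of_real a powr (s - 1) * of_real t powr (s - 1)"
    using assms True by (simp add: powr_times_real)
  moreover have "complex_of_real a powr (1 - s) * of_real a powr (s - 1) = 1"
    using assms powr_add[of "of_real a" "1 - s" "s - 1"] by simp
  ultimately show ?thesis using assms True
    by (simp add: Gamma_kernel_def mult.assoc[symmetric])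
next
  case False
  thus ?thesis using assms by (simp add: Gamma_kernel_def zero_less_mult_iff)
qed

lemma has_bochner_integral_Gamma_kernel:
  assumes "Re s > 0" "a > 0"
  shows "has_bochner_integral lborel (Gamma_kernel s a) (Gamma s / of_real a powr s)"
proof -
  have "has_bochner_integral lborel (\<lambda>t. Gamma_kernel s 1 (0 + a * t)) (Gamma s /\<^sub>R \<bar>a\<bar>)"
    using has_bochner_integral_Gamma_kernel_1[OF assms(1)] assms(2)
    by (subst (asm) lborel_has_bochner_integral_real_affine_iff[of a _ _ 0]) auto
  hence "has_bochner_integral lborel (\<lambda>t. of_real a powr (1 - s) * Gamma_kernel s 1 (0 + a * t))
           (of_real a powr (1 - s) * (Gamma s /\<^sub>R \<bar>a\<bar>))"
    by (rule has_bochner_integral_mult_right)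
  also have "(\<lambda>t. of_real a powr (1 - s) * Gamma_kernel s 1 (0 + a * t)) = Gamma_kernel s a"
    by (rule ext) (rule Gamma_kernel_scale[OF assms(2), symmetric])
  also have "of_real a powr (1 - s) * (Gamma s /\<^sub>R \<bar>a\<bar>) = Gamma s / of_real a powr s"
    using assms(2) by (simp add: powr_diff scaleR_conv_of_real field_simps)
  finally show ?thesis .
qed

lemma integral_norm_Gamma_kernel:
  assumes "a > 0"
  shows "(\<integral>t. norm (Gamma_kernel s a t) \<partial>lborel)
           = a powr (- Re s) * (\<integral>t. norm (Gamma_kernel s 1 t) \<partial>lborel)"
proof -
  have "(\<integral>t. norm (Gamma_kernel s 1 t) \<partial>lborel)
          = a * (\<integral>t. norm (Gamma_kernel s 1 (0 + a * t)) \<partial>lborel)"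
    using assms lborel_integral_real_affine[of a "\<lambda>t. norm (Gamma_kernel s 1 t)" 0] by simp
  moreover have "(\<integral>t. norm (Gamma_kernel s a t) \<partial>lborel)
          = a powr (1 - Re s) * (\<integral>t. norm (Gamma_kernel s 1 (0 + a * t)) \<partial>lborel)"
    unfolding Gamma_kernel_scale[OF assms] norm_mult cmod_of_real_powr[OF assms] by simp
  moreover have "a powr (1 - Re s) = a powr (- Re s) * a"
    using assms by (simp add: powr_diff powr_minus field_simps)
  ultimately show ?thesis by simp
qed

text \<open>Sum and integral may be exchanged because the L1 norms of the terms are at most C * K *
  n^(-Re s), which is summable for Re s > 1. The condition \<open>w 0 = 0\<close> removes the term
  t^(s-1), which is not integrable over the half-line.\<close>

lemma Mellin_powser_exp:
  fixes w :: "nat \<Rightarrow> real"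
  assumes "\<And>n. \<bar>w n\<bar> \<le> C" "w 0 = 0" "Re s > 1"
  shows "has_bochner_integral lborel
           (\<lambda>t. indicator {0<..} t *\<^sub>R (of_real t powr (s - 1) * of_real (powser w (exp (- t)))))
           (Gamma s * (\<Sum>n. of_real (w n) / of_nat n powr s))"
proof -
  define f where "f = (\<lambda>n t. complex_of_real (w n) * Gamma_kernel s (real n) t)"
  have s: "Re s > 0" using assms by simp
  have f: "has_bochner_integral lborel (f n) (of_real (w n) * (Gamma s / of_nat n powr s))" for n
  proof (cases "n = 0")
    case False
    show ?thesis unfolding f_def
      using has_bochner_integral_mult_right[OF has_bochner_integral_Gamma_kernel[OF s, of n], of "of_real (w n)"] False
      by simp
  qed (auto simp: f_def assms)
  have int: "integrable lborel (f n)" for n using f[of n] by (simp add: has_bochner_integral_iff)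
  have fsums: "summable (\<lambda>n. norm (f n t)) \<and>
     (\<lambda>n. f n t) sums (indicator {0<..} t *\<^sub>R (of_real t powr (s - 1) * of_real (powser w (exp (- t)))))" for t
  proof (cases "t > 0")
    case True
    have eq: "f n t = of_real t powr (s - 1) * of_real (w n * exp (- t) ^ n)" for n
      using True exp_of_nat_mult[of n "- t"] by (simp add: f_def Gamma_kernel_def)
    have "summable (\<lambda>n. norm (w n * exp (- t) ^ n))"
      by (rule summable_powser[OF assms(1)]) (use True in auto)
    hence "summable (\<lambda>n. norm (f n t))"
      unfolding eq norm_mult norm_of_real by (intro summable_mult) (simp only: real_norm_def abs_mult)
    moreover have "(\<lambda>n. w n * exp (- t) ^ n) sums powser w (exp (- t))"
      by (rule powser_sums[OF assms(1)]) (use True in auto)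
    hence "(\<lambda>n. f n t) sums (of_real t powr (s - 1) * of_real (powser w (exp (- t))))"
      unfolding eq by (intro sums_mult sums_of_real)
    ultimately show ?thesis using True by simp
  qed (auto simp: f_def Gamma_kernel_def)
  define K where "K = (\<integral>t. norm (Gamma_kernel s 1 t) \<partial>lborel)"
  have normint: "(\<integral>t. norm (f n t) \<partial>lborel) = \<bar>w n\<bar> * (real n powr (- Re s) * K)" for n
  proof (cases "n = 0")
    case False
    thus ?thesis using integral_norm_Gamma_kernel[of "real n" s] by (simp add: f_def norm_mult K_def)
  qed (simp add: f_def assms)
  have summ: "summable (\<lambda>n. \<integral>t. norm (f n t) \<partial>lborel)"
  proof (rule summable_comparison_test')
    show "summable (\<lambda>n. C * (real n powr (- Re s) * K))"
      using assms by (intro summable_mult summable_mult2) (simp add: summable_real_powr_iff)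
    show "norm (\<integral>t. norm (f n t) \<partial>lborel) \<le> C * (real n powr (- Re s) * K)" if "n \<ge> 0" for n
    proof -
      have "K \<ge> 0" unfolding K_def by simp
      thus ?thesis unfolding normint using assms(1)[of n] by (auto simp: abs_mult intro!: mult_right_mono)
    qed
  qed
  have "integrable lborel (\<lambda>t. \<Sum>n. f n t)"
    by (rule integrable_suminf[OF int _ summ]) (use fsums in auto)
  moreover have "(\<lambda>n. integral\<^sup>L lborel (f n)) sums (\<integral>t. (\<Sum>n. f n t) \<partial>lborel)"
    by (rule sums_integral[OF int _ summ]) (use fsums in auto)
  hence "(\<integral>t. (\<Sum>n. f n t) \<partial>lborel) = (\<Sum>n. of_real (w n) * (Gamma s / of_nat n powr s))"
    using f by (simp add: has_bochner_integral_iff sums_iff)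
  moreover have "(\<Sum>n. of_real (w n) * (Gamma s / of_nat n powr s)) = Gamma s * (\<Sum>n. of_real (w n) / of_nat n powr s)"
  proof -
    have "summable (\<lambda>n. norm (complex_of_real (w n) / of_nat n powr s))"
      by (rule summable_Dirichlet_bounded[OF assms(1,3)])
    from suminf_mult[OF summable_norm_cancel[OF this], of "Gamma s"] show ?thesis
      by (simp add: mult_ac)
  qed
  moreover have "(\<lambda>t. \<Sum>n. f n t) = (\<lambda>t. indicator {0<..} t *\<^sub>R (of_real t powr (s - 1) * of_real (powser w (exp (- t)))))"
    using fsums by (auto simp: sums_iff)
  ultimately show ?thesis by (simp add: has_bochner_integral_iff)
qed

section \<open>From the nested sum to the power series\<close>

text \<open>The fibre over m of the map sending an index tuple of \<open>Li\<close> to its largest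
  entry; unlike the whole index set, it is finite.\<close>

definition index_lists :: "nat \<Rightarrow> nat \<Rightarrow> nat list set" where
  "index_lists r m = {ms. length ms = Suc r \<and> sorted_wrt (<) ms \<and> (\<forall>k\<in>set ms. 1 \<le> k) \<and> last ms = m}"

definition list_weight :: "nat list \<Rightarrow> real" where
  "list_weight ms = 1 / (real (hd ms) ^ 2 * prod_list (map real (tl ms)))"

lemma list_weight_nonneg: "list_weight ms \<ge> 0"
  unfolding list_weight_def by (intro divide_nonneg_nonneg mult_nonneg_nonneg prod_list_nonneg) auto

lemma index_lists_0: "index_lists 0 m = (if m = 0 then {} else {[m]})"
  by (auto simp: index_lists_def length_Suc_conv)

text \<open>Removing the last entry m leaves a tuple whose own last entry k is smaller; this mirrors
  the recursion of \<open>Li_coeff\<close>.\<close>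

lemma index_lists_Suc: "index_lists (Suc r) m = (\<Union>k<m. (\<lambda>ms. ms @ [m]) ` index_lists r k)"
proof (intro equalityI subsetI)
  fix ms assume ms: "ms \<in> index_lists (Suc r) m"
  then obtain xs where xs: "ms = xs @ [m]"
    by (cases ms rule: rev_cases) (auto simp: index_lists_def)
  hence "xs \<noteq> []" using ms by (auto simp: index_lists_def)
  with ms xs have "xs \<in> index_lists r (last xs)" "last xs < m"
    by (auto simp: index_lists_def sorted_wrt_append)
  thus "ms \<in> (\<Union>k<m. (\<lambda>ms. ms @ [m]) ` index_lists r k)" using xs by auto
next
  fix ms assume "ms \<in> (\<Union>k<m. (\<lambda>ms. ms @ [m]) ` index_lists r k)"
  then obtain k xs where k: "k < m" "ms = xs @ [m]" "xs \<in> index_lists r k" by auto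
  then obtain ys where "xs = ys @ [k]"
    by (cases xs rule: rev_cases) (auto simp: index_lists_def)
  with k show "ms \<in> index_lists (Suc r) m"
    by (fastforce simp: index_lists_def sorted_wrt_append)
qed

lemma finite_index_lists: "finite (index_lists r m)"
  by (induction r arbitrary: m) (auto simp: index_lists_0 index_lists_Suc)

lemma sum_list_weight: "(\<Sum>ms\<in>index_lists r m. list_weight ms) = Li_coeff r m"
proof (induction r arbitrary: m)
  case 0
  show ?case by (simp add: index_lists_0 list_weight_def)
next
  case (Suc r)
  have "(\<Sum>ms\<in>index_lists (Suc r) m. list_weight ms)
          = (\<Sum>k<m. \<Sum>ms\<in>(\<lambda>ms. ms @ [m]) ` index_lists r k. list_weight ms)"
    unfolding index_lists_Suc
    by (rule sum.UNION_disjoint) (auto simp: finite_index_lists, auto simp: index_lists_def)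
  also have "\<dots> = (\<Sum>k<m. \<Sum>ms\<in>index_lists r k. list_weight (ms @ [m]))"
    by (subst sum.reindex) (auto simp: inj_on_def)
  also have "\<dots> = (\<Sum>k<m. \<Sum>ms\<in>index_lists r k. list_weight ms / real m)"
  proof (intro sum.cong refl)
    fix k ms assume "ms \<in> index_lists r k"
    hence "ms \<noteq> []" by (auto simp: index_lists_def)
    thus "list_weight (ms @ [m]) = list_weight ms / real m"
      by (cases ms) (auto simp: list_weight_def)
  qed
  also have "\<dots> = Li_coeff (Suc r) m"
    by (simp add: Suc.IH flip: sum_divide_distrib)
  finally show ?case .
qed

text \<open>Group the tuples by their largest entry. For x >= 0 all terms are nonnegative, so the
  iterated sum already gives unordered summability.\<close>

lemma Li_eq_powser:
  assumes "0 \<le> x" "x < 1"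
  shows "Li (map int (2 # replicate r 1)) (of_real x) = of_real (powser (Li_coeff r) x)"
proof -
  define S where "S = {ms :: nat list. length ms = Suc r \<and> sorted_wrt (<) ms \<and> (\<forall>m\<in>set ms. 1 \<le> m)}"
  define f where "f = (\<lambda>ms. list_weight ms * x ^ last ms)"
  have inner: "((\<lambda>y. case (m, y) of (_, ms) \<Rightarrow> f ms) has_sum (Li_coeff r m * x ^ m)) (index_lists r m)" for m
  proof -
    have "(\<Sum>ms\<in>index_lists r m. f ms) = (\<Sum>ms\<in>index_lists r m. list_weight ms * x ^ m)"
      by (intro sum.cong) (auto simp: f_def index_lists_def)
    also have "\<dots> = Li_coeff r m * x ^ m"
      by (simp add: sum_list_weight flip: sum_distrib_right)
    finally show ?thesis by (intro has_sum_finiteI finite_index_lists) auto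
  qed
  have outer: "((\<lambda>m. Li_coeff r m * x ^ m) has_sum powser (Li_coeff r) x) UNIV"
    using assms powser_sums[where a = "Li_coeff r", OF abs_Li_coeff_le_1]
    by (intro sums_nonneg_imp_has_sum) (auto intro!: mult_nonneg_nonneg Li_coeff_nonneg)
  have "((\<lambda>(_, ms). f ms) has_sum powser (Li_coeff r) x) (Sigma UNIV (index_lists r))"
  proof (rule has_sum_SigmaI[OF inner outer])
    show "(\<lambda>(_, ms). f ms) summable_on Sigma UNIV (index_lists r)"
      by (rule summable_on_SigmaI[OF inner])
         (use outer assms in \<open>auto simp: f_def summable_on_def intro!: mult_nonneg_nonneg list_weight_nonneg\<close>)
  qed
  also have "?this \<longleftrightarrow> (f has_sum powser (Li_coeff r) x) S"
    by (rule has_sum_reindex_bij_witness[of _ "\<lambda>ms. (last ms, ms)" snd])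
       (auto simp: S_def index_lists_def)
  finally have "((\<lambda>ms. complex_of_real (f ms)) has_sum of_real (powser (Li_coeff r) x)) S"
    by (rule has_sum_of_real)
  moreover have "complex_of_real (f ms) = of_real x ^ last ms /
     (\<Prod>i<length (map int (2 # replicate r 1)). of_nat (ms ! i) powi (map int (2 # replicate r 1) ! i))"
    if "ms \<in> S" for ms
  proof -
    from that obtain a as where as: "ms = a # as" "length as = r"
      by (auto simp: S_def length_Suc_conv)
    have "(\<Prod>i<length (map int (2 # replicate r 1)). complex_of_nat (ms ! i) powi (map int (2 # replicate r 1) ! i))
            = of_nat a ^ 2 * (\<Prod>i<r. of_nat (as ! i))"
      by (simp add: as prod.lessThan_Suc_shift del: prod.lessThan_Suc)
    also have "(\<Prod>i<r. complex_of_nat (as ! i)) = of_real (prod_list (map real as))"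
      by (simp add: prod.list_conv_set_nth as atLeast0LessThan)
    finally show ?thesis by (simp add: f_def list_weight_def as)
  qed
  ultimately have "((\<lambda>ms. of_real x ^ last ms /
     (\<Prod>i<length (map int (2 # replicate r 1)). of_nat (ms ! i) powi (map int (2 # replicate r 1) ! i)))
     has_sum complex_of_real (powser (Li_coeff r) x)) S"
    by (simp cong: has_sum_cong)
  thus ?thesis unfolding Li_def S_def by (simp add: infsumI)
qed

section \<open>Zeta and double zeta as Dirichlet series\<close>

lemma of_nat_powr_Suc:
  "complex_of_nat (Suc n) powr of_nat k = of_nat (Suc n) ^ k"
  by (rule powr_nat') (simp del: of_nat_Suc)

lemma riemann_zeta_eq_suminf:
  assumes "Re s > 1"
  shows "riemann_zeta s = (\<Sum>n. of_real (inv_power 0 n) / of_nat n powr s)"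
proof -
  have summ: "summable (\<lambda>n. norm (complex_of_real (inv_power 0 n) / of_nat n powr s))"
    by (rule summable_Dirichlet_bounded[where w = "inv_power 0", OF abs_inv_power_le_1 assms])
  have "((\<lambda>n. complex_of_real (inv_power 0 n) / of_nat n powr s) has_sum
           (\<Sum>n. of_real (inv_power 0 n) / of_nat n powr s)) UNIV"
    by (rule norm_summable_imp_has_sum[OF summ summable_sums[OF summable_norm_cancel[OF summ]]])
  also have "?this \<longleftrightarrow> ((\<lambda>n. 1 / of_nat n powr s) has_sum
           (\<Sum>n. of_real (inv_power 0 n) / of_nat n powr s)) {1..}"
    by (rule has_sum_cong_neutral) (auto simp: inv_power_def)
  finally show ?thesis by (simp add: riemann_zeta_def infsumI)
qed

lemma riemann_zeta_of_nat:
  assumes "k \<ge> 2"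
  shows "riemann_zeta (of_nat k) = of_real (zeta_real k)"
proof -
  have "complex_of_real (inv_power 0 n) / of_nat n powr of_nat k = of_real (inv_power k n)" for n
    by (cases n) (simp_all add: inv_power_def of_nat_powr_Suc del: of_nat_Suc)
  moreover have "(\<lambda>n. complex_of_real (inv_power k n)) sums of_real (zeta_real k)"
    using summable_inv_power[OF assms]
    by (intro sums_of_real) (simp add: zeta_real_def powser_def sums_iff)
  ultimately show ?thesis using assms
    by (subst riemann_zeta_eq_suminf) (auto simp: sums_iff)
qed

text \<open>Provides the bounded coefficients that \<open>Mellin_powser_exp\<close> demands. For k =
  1 these are harmonic numbers and no bound exists.\<close>

lemma sum_inv_power_le:
  assumes "k \<ge> 2"
  shows "\<bar>\<Sum>i<n. inv_power k i\<bar> \<le> zeta_real k"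
proof -
  have "(\<Sum>i<n. inv_power k i) \<le> (\<Sum>i. inv_power k i)"
    by (intro sum_le_suminf summable_inv_power assms) (auto simp: inv_power_nonneg)
  thus ?thesis by (simp add: zeta_real_def powser_def sum_nonneg inv_power_nonneg)
qed

text \<open>Group by the larger index. The inner sums are finite with summands of constant phase, so
  the norm of an inner sum is the sum of the norms, and absolute summability of the outer series
  carries over to the pairs.\<close>

lemma double_zeta_eq_suminf:
  assumes "k \<ge> 2" "Re s > 1"
  shows "double_zeta k s = (\<Sum>n. of_real (\<Sum>i<n. inv_power k i) / of_nat n powr s)"
proof -
  let ?w = "\<lambda>n. \<Sum>i<n. inv_power k i"
  have summ: "summable (\<lambda>n. norm (complex_of_real (?w n) / of_nat n powr s))"
    by (rule summable_Dirichlet_bounded[where w = ?w, OF sum_inv_power_le[OF assms(1)] assms(2)])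
  define f where "f = (\<lambda>(m, m1). complex_of_real (inv_power k m1) / of_nat m powr s)"
  have w: "?w m = (\<Sum>i = 1..<m. inv_power k i)" for m
    by (rule sum.mono_neutral_right) (auto simp: inv_power_def)
  have inner: "((\<lambda>m1. f (m, m1)) has_sum (of_real (?w m) / of_nat m powr s)) {1..<m}" for m
    by (rule has_sum_finiteI) (simp_all add: w f_def sum_divide_distrib)
  have "norm (complex_of_real (?w m) / of_nat m powr s) = ?w m / norm (of_nat m powr s)" for m
    unfolding norm_divide norm_of_real by (simp add: sum_nonneg inv_power_nonneg)
  hence inner': "((\<lambda>m1. norm (f (m, m1))) has_sum norm (complex_of_real (?w m) / of_nat m powr s)) {1..<m}" for m
    by (intro has_sum_finiteI)
       (simp_all add: w f_def norm_divide inv_power_nonneg sum_divide_distrib)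
  have "(\<lambda>p. norm (f p)) summable_on (Sigma UNIV (\<lambda>m. {1..<m}))"
    using summ by (intro summable_on_SigmaI[OF inner'] summable_nonneg_imp_summable_on) auto
  hence "f summable_on (Sigma UNIV (\<lambda>m. {1..<m}))"
    by (rule abs_summable_summable)
  moreover have "((\<lambda>n. complex_of_real (?w n) / of_nat n powr s) has_sum (\<Sum>n. of_real (?w n) / of_nat n powr s)) UNIV"
    by (rule norm_summable_imp_has_sum[OF summ summable_sums[OF summable_norm_cancel[OF summ]]])
  ultimately have "(f has_sum (\<Sum>n. of_real (?w n) / of_nat n powr s)) (Sigma UNIV (\<lambda>m. {1..<m}))"
    using inner by (intro has_sum_SigmaI) auto
  also have "?this \<longleftrightarrow> ((\<lambda>(m1, m). 1 / (of_nat m1 ^ k * of_nat m powr s)) has_sum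
       (\<Sum>n. of_real (?w n) / of_nat n powr s)) {(m1, m). 1 \<le> m1 \<and> m1 < m}"
    by (rule has_sum_reindex_bij_witness[of _ "\<lambda>(a, b). (b, a)" "\<lambda>(a, b). (b, a)"])
       (auto simp: f_def inv_power_def)
  finally show ?thesis by (simp add: double_zeta_def infsumI)
qed

section \<open>Mellin transforms of the individual terms\<close>

text \<open>Here 1 / (e^t - 1) is Li_0(e^{-t}), the series with all coefficients 1 from n = 1
  on.\<close>

lemma Mellin_zeta:
  assumes "Re s > 1"
  shows "has_bochner_integral lborel
           (\<lambda>t. indicator {0<..} t *\<^sub>R (of_real t powr (s - 1) * of_real (1 / (exp t - 1))))
           (Gamma s * riemann_zeta s)"
  using Mellin_powser_exp[where w = "inv_power 0" and s = s, OF abs_inv_power_le_1 _ assms]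
  unfolding riemann_zeta_eq_suminf[OF assms]
  by (rule has_bochner_integral_cong[THEN iffD1, rotated -1]) (auto simp: indicator_def Li_exp_0)

lemma Mellin_double_zeta:
  assumes "k \<ge> 2" "Re s > 1"
  shows "has_bochner_integral lborel
           (\<lambda>t. indicator {0<..} t *\<^sub>R (of_real t powr (s - 1) * of_real (Li_exp k t / (exp t - 1))))
           (Gamma s * double_zeta k s)"
proof -
  let ?w = "\<lambda>n. \<Sum>i<n. inv_power k i"
  have eq: "powser ?w (exp (- t)) = Li_exp k t / (exp t - 1)" if "t > 0" for t
  proof -
    have "powser ?w (exp (- t)) = exp (- t) / (1 - exp (- t)) * Li_exp k t"
      using powser_sums_lessThan[where a = "inv_power k" and x = "exp (- t)", OF abs_inv_power_le_1] that
      by (simp add: powser_def sums_iff)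
    also have "exp (- t) / (1 - exp (- t)) = 1 / (exp t - 1)"
      using that by (simp add: exp_minus field_simps)
    finally show ?thesis by simp
  qed
  show ?thesis
    using Mellin_powser_exp[where w = ?w and s = s, OF sum_inv_power_le[OF assms(1)] _ assms(2)]
    unfolding double_zeta_eq_suminf[OF assms]
    by (rule has_bochner_integral_cong[THEN iffD1, rotated -1]) (auto simp: indicator_def eq)
qed

section \<open>Assembling the identity\<close>

text \<open>Absorbs t^j into the Mellin exponent, which moves the evaluation point from s to s +
  j.\<close>

lemma of_real_powr_times_power:
  assumes "t > 0"
  shows "complex_of_real t powr (s + of_nat j - 1) = of_real t powr (s - 1) * of_real t ^ j"
proof -
  have "complex_of_real t powr (s + of_nat j - 1) = of_real t powr ((s - 1) + of_nat j)"
    by (simp add: algebra_simps)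
  also have "\<dots> = of_real t powr (s - 1) * of_real t powr of_nat j"
    by (rule powr_add)
  also have "complex_of_real t powr of_nat j = of_real t ^ j"
    using assms by (intro powr_nat') auto
  finally show ?thesis .
qed

text \<open>Gamma(s+j) / Gamma(s) is the rising factorial s(s+1)...(s+j-1); this is the origin of
  the binomial coefficient.\<close>

lemma Gamma_shift_eq_gbinomial:
  assumes "Re s > 0"
  shows "Gamma (s + of_nat j) = Gamma s * fact j * ((s + of_nat j - 1) gchoose j)"
proof -
  have "s \<notin> \<int>\<^sub>\<le>\<^sub>0" using assms by (auto elim!: nonpos_Ints_cases)
  thus ?thesis
    by (simp add: gbinomial_pochhammer' pochhammer_Gamma Gamma_eq_zero_iff)
qed

theorem theorem3p8:
  fixes r :: nat and s :: complex
  assumes "r \<ge> 1" and "Re s > 1"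
  shows "(-1) ^ r * xi (2 # replicate r 1) s =
           - of_nat (r + 1) * double_zeta (r + 2) s
           - s * double_zeta (r + 1) (s + 1)
           + (\<Sum>j=0..r. (-1) ^ j * of_nat (r - j + 1) * riemann_zeta (of_nat (r - j + 2))
                          * ((s + of_nat j - 1) gchoose j) * riemann_zeta (s + of_nat j))"
proof -
  have "s \<notin> \<int>\<^sub>\<le>\<^sub>0" using assms by (auto elim!: nonpos_Ints_cases)
  hence G: "Gamma s \<noteq> 0" by (simp add: Gamma_eq_zero_iff)
  define c :: "nat \<Rightarrow> complex" where
    "c j = (-1) ^ j * of_nat (r - j + 1) * of_real (zeta_real (r - j + 2)) / fact j" for j
  define T where "T = (\<lambda>z F t. indicator {0<..} t *\<^sub>R (complex_of_real t powr (z - 1) * of_real (F t :: real)))"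
  have I1: "has_bochner_integral lborel (T (s + of_nat j) (\<lambda>t. 1 / (exp t - 1)))
              (Gamma (s + of_nat j) * riemann_zeta (s + of_nat j))" for j
    unfolding T_def by (rule Mellin_zeta) (use assms in auto)
  \<comment> \<open>Here r >= 1 is used: it gives r + 1 >= 2, as bounded coefficients
    require.\<close>
  have I2: "has_bochner_integral lborel (T (s + 1) (\<lambda>t. Li_exp (r + 1) t / (exp t - 1)))
              (Gamma (s + 1) * double_zeta (r + 1) (s + 1))"
    unfolding T_def by (rule Mellin_double_zeta) (use assms in auto)
  have I3: "has_bochner_integral lborel (T s (\<lambda>t. Li_exp (r + 2) t / (exp t - 1)))
              (Gamma s * double_zeta (r + 2) s)"
    unfolding T_def by (rule Mellin_double_zeta) (use assms in auto)
  let ?J = "(\<Sum>j\<le>r. c j * (Gamma (s + of_nat j) * riemann_zeta (s + of_nat j)))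
             - Gamma (s + 1) * double_zeta (r + 1) (s + 1)
             - of_nat (r + 1) * (Gamma s * double_zeta (r + 2) s)"
  have "has_bochner_integral lborel
          (\<lambda>t. (\<Sum>j\<le>r. c j * T (s + of_nat j) (\<lambda>t. 1 / (exp t - 1)) t)
               - T (s + 1) (\<lambda>t. Li_exp (r + 1) t / (exp t - 1)) t
               - of_nat (r + 1) * T s (\<lambda>t. Li_exp (r + 2) t / (exp t - 1)) t) ?J"
    by (intro has_bochner_integral_diff has_bochner_integral_sum has_bochner_integral_mult_right I1 I2 I3)
  also have "(\<lambda>t. (\<Sum>j\<le>r. c j * T (s + of_nat j) (\<lambda>t. 1 / (exp t - 1)) t)
               - T (s + 1) (\<lambda>t. Li_exp (r + 1) t / (exp t - 1)) t
               - of_nat (r + 1) * T s (\<lambda>t. Li_exp (r + 2) t / (exp t - 1)) t)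
      = (\<lambda>t. (-1) ^ r * (indicator {0<..} t *\<^sub>R
           (of_real t powr (s - 1) * Li (map int (2 # replicate r 1)) (1 - exp (- of_real t))
                        / (exp (of_real t) - 1))))" (is "?f = ?g")
  proof
    fix t :: real
    show "?f t = ?g t"
    proof (cases "t > 0")
      case True
      let ?P = "complex_of_real t powr (s - 1)" and ?E = "complex_of_real (exp t) - 1"
      have Li: "Li (map int (2 # replicate r 1)) (1 - exp (- of_real t)) = of_real (iter_Li r t)"
        using Li_eq_powser[of "1 - exp (- t)" r] True by (simp add: iter_Li_def exp_of_real[symmetric])
      have "?g t = ?P * of_real ((-1) ^ r * iter_Li r t) / ?E"
        using True unfolding Li by (simp add: exp_of_real)
      also have "\<dots> = ?P * of_real (iter_closed r t) / ?E"
        using iter_Li_eq[OF True] by simp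
      also have "of_real (iter_closed r t) = (\<Sum>j\<le>r. c j * of_real t ^ j)
                    - of_real t * of_real (Li_exp (r + 1) t) - of_nat (r + 1) * of_real (Li_exp (r + 2) t)"
        by (simp add: iter_closed_def c_def)
      also have "?P * \<dots> / ?E = ?f t"
        using True of_real_powr_times_power[OF True, of s 1]
        by (simp add: T_def of_real_powr_times_power sum_distrib_left sum_divide_distrib
              ring_distribs diff_divide_distrib add_divide_distrib mult_ac)
      finally show ?thesis ..
    qed (simp add: T_def)
  qed
  finally have "(LBINT t. ?g t) = ?J" by (simp only: has_bochner_integral_iff)
  hence "(-1) ^ r * (Gamma s * xi (2 # replicate r 1) s) = ?J"
    using G unfolding xi_def set_lebesgue_integral_def integral_mult_right_zero by simp
  \<comment> \<open>The instance j = 1 of the Gamma shift produces the factor s of the second double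
    zeta term.\<close>
  also have "?J = Gamma s * ((\<Sum>j\<le>r. c j * fact j * ((s + of_nat j - 1) gchoose j) * riemann_zeta (s + of_nat j))
             - s * double_zeta (r + 1) (s + 1) - of_nat (r + 1) * double_zeta (r + 2) s)"
    using assms Gamma_shift_eq_gbinomial[of s] Gamma_shift_eq_gbinomial[of s 1]
    by (simp add: sum_distrib_left right_diff_distrib mult_ac)
  finally have "(-1) ^ r * xi (2 # replicate r 1) s =
      (\<Sum>j\<le>r. c j * fact j * ((s + of_nat j - 1) gchoose j) * riemann_zeta (s + of_nat j))
             - s * double_zeta (r + 1) (s + 1) - of_nat (r + 1) * double_zeta (r + 2) s"
    using G by (simp add: mult.left_commute)
  \<comment> \<open>The factorial from the Gamma shift cancels the 1/j! of the polynomial.\<close>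
  moreover have "c j * fact j = (-1) ^ j * of_nat (r - j + 1) * riemann_zeta (of_nat (r - j + 2))" for j
    by (subst riemann_zeta_of_nat) (auto simp: c_def)
  ultimately show ?thesis by (simp only: atMost_atLeast0 mult_minus_left) simp
qed

end
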